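(* Let $\pi_s$ be any sampling distribution satisfying $$\forall x,\quad \{y\mid\pi_{\theta'}(y|x)>0\}\subseteq\{y\mid\pi_s(y|x)>0\}.$$ Then the unique optimal policy that minimizes $\hat{\mathcal L}_{\mathrm{GVPO}}(\theta)$, defined as $$\hat{\mathcal L}_{\mathrm{GVPO}}(\theta)=\mathbb{E}_{x\sim\mathcal D}\,\mathbb{E}_{y\sim\pi_s(\cdot|x)}\Big[\big(R_\theta(x,y)-\mathbb{E}_{y\sim\pi_s}R_\theta(x,y)\big)-\big(R(x,y)-\mathbb{E}_{y\sim\pi_s}R(x,y)\big)\Big]^2 ,$$ is given by $$\pi_\theta(y|x)=\pi^*(y|x)=\frac{1}{Z(x)}\,\pi_{\theta'}(y|x)\,e^{R(x,y)/\beta}.$$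
   Context: A (large language model) policy $\pi$ takes a prompt $x$ and generates a response $y$; $\pi(y|x)$ denotes the probability of generating $y$ from $x$. $\mathcal D$ is the distribution of prompts. $R(x,y)$ is a reward model scoring the response $y$ as a reply to the prompt $x$. $\beta>0$ is a constant, $\pi_{\theta'}$ is a given policy (the one relative to which the KL divergence is penalized), $\pi_\theta$ is the policy being optimized, and $\pi_s$ is the distribution from which responses are sampled. The partition function is $Z(x)=\sum_y\pi_{\theta'}(y|x)e^{R(x,y)/\beta}$, and the implicit reward of $\pi_\theta$ is $R_\theta(x,y)=\beta\log\frac{\pi_\theta(y|x)}{\pi_{\theta'}(y|x)}+\beta\log Z(x)$. The inner expectations $\mathbb{E}_{y\sim\pi_s}$ are over $y\sim\pi_s(\cdot|x)$ for the given $x$. The policy $\pi^*$ is the optimal solution of the KL-constrained reward maximization problem $\max_{\pi_\theta}\mathbb{E}_{x\sim\mathcal D,\,y\sim\pi_\theta(y|x)}[R(x,y)]-\beta\,\mathbb{D}_{KL}[\pi_\theta(y|x)\,\|\,\pi_{\theta'}(y|x)]$.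
   Formalization: Competing policies put mass only where π_θ' does; where both vanish, log(0/0) is undefined and R_θ is set to R; Z(x) is assumed finite; uniqueness is for prompts of positive D-probability; π* solves the KL problem if its objective is finite. *)

theory Defs
  imports "HOL-Probability.Probability"
begin

text \<open>
  Prompts have type \<open>'x\<close>, responses type \<open>'y\<close>; a policy \<open>\<pi> :: 'x \<Rightarrow> 'y pmf\<close> gives the
  probability of \<open>y\<close> given \<open>x\<close> as \<open>pmf (\<pi> x) y\<close>.
\<close>

definition partition_fun ::
    "real \<Rightarrow> ('x \<Rightarrow> 'y \<Rightarrow> real) \<Rightarrow> ('x \<Rightarrow> 'y pmf) \<Rightarrow> 'x \<Rightarrow> real" where
  "partition_fun \<beta> R \<pi>ref x = (\<Sum>\<^sub>\<infinity>y. pmf (\<pi>ref x) y * exp (R x y / \<beta>))"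

text \<open>
  The competing policies: only responses that \<open>\<pi>ref\<close> can generate are generated, as is necessary
  for a finite KL divergence.  Without this restriction mass outside the supports of both \<open>\<pi>ref\<close>
  and \<open>\<pi>s\<close> would be invisible to the GVPO loss, and minimizers would not be unique.
  Prompts of probability 0 are irrelevant.
\<close>

definition policies :: "'x pmf \<Rightarrow> ('x \<Rightarrow> 'y pmf) \<Rightarrow> ('x \<Rightarrow> 'y pmf) set" where
  "policies D \<pi>ref = {\<pi>. \<forall>x\<in>set_pmf D. \<forall>y. pmf (\<pi> x) y > 0 \<longrightarrow> pmf (\<pi>ref x) y > 0}"

text \<open>
  The implicit reward is the number \<open>r\<close> with
  \<open>pmf (\<pi> x) y = pmf (\<pi>ref x) y * exp (r / \<beta>) / Z x\<close>.  If both probabilities vanish, the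
  log-ratio is of the form log (0/0) and every \<open>r\<close> solves this equation; the value is then fixed
  to be \<open>R x y\<close>, so that the implicit reward of the optimal policy is \<open>R\<close> at every response.
  (With a constant value instead, the optimal policy would in general not minimize the GVPO loss
  if \<open>\<pi>s\<close> samples responses that \<open>\<pi>ref\<close> cannot generate.)
  If exactly one of the two probabilities vanishes, the implicit reward is infinite; this case
  is treated in the loss.
\<close>

definition implicit_reward ::
    "real \<Rightarrow> ('x \<Rightarrow> 'y \<Rightarrow> real) \<Rightarrow> ('x \<Rightarrow> 'y pmf) \<Rightarrow> ('x \<Rightarrow> 'y pmf) \<Rightarrow> 'x \<Rightarrow> 'y \<Rightarrow> real" where
  "implicit_reward \<beta> R \<pi>ref \<pi> x y =
     (if pmf (\<pi> x) y = 0 \<and> pmf (\<pi>ref x) y = 0 then R x y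
      else \<beta> * ln (pmf (\<pi> x) y / pmf (\<pi>ref x) y) + \<beta> * ln (partition_fun \<beta> R \<pi>ref x))"

text \<open>
  The expectation of the (nonnegative) square takes values in \<open>[0, \<infinity>]\<close>.  It is \<open>\<infinity>\<close> for a prompt
  at which the implicit reward of a response sampled by \<open>\<pi>s\<close> is infinite.
  If \<open>R x\<close> is integrable with respect to \<open>\<pi>s x\<close> but the implicit reward is not, then the square
  has infinite expectation whatever value is used for the missing mean, so the default value
  \<open>0\<close> of the integral does no harm.
\<close>

definition gvpo_loss ::
    "real \<Rightarrow> ('x \<Rightarrow> 'y \<Rightarrow> real) \<Rightarrow> 'x pmf \<Rightarrow> ('x \<Rightarrow> 'y pmf) \<Rightarrow> ('x \<Rightarrow> 'y pmf) \<Rightarrow>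
     ('x \<Rightarrow> 'y pmf) \<Rightarrow> ennreal" where
  "gvpo_loss \<beta> R D \<pi>ref \<pi>s \<pi> =
     (\<integral>\<^sup>+ x. (if \<exists>y\<in>set_pmf (\<pi>s x). (pmf (\<pi> x) y = 0) \<noteq> (pmf (\<pi>ref x) y = 0) then \<infinity>
       else \<integral>\<^sup>+ y. ennreal
         (((implicit_reward \<beta> R \<pi>ref \<pi> x y
              - measure_pmf.expectation (\<pi>s x) (implicit_reward \<beta> R \<pi>ref \<pi> x))
           - (R x y - measure_pmf.expectation (\<pi>s x) (R x)))\<^sup>2) \<partial>measure_pmf (\<pi>s x))
      \<partial>measure_pmf D)"

definition gvpo_optimal ::
    "real \<Rightarrow> ('x \<Rightarrow> 'y \<Rightarrow> real) \<Rightarrow> 'x pmf \<Rightarrow> ('x \<Rightarrow> 'y pmf) \<Rightarrow> ('x \<Rightarrow> 'y pmf) \<Rightarrow>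
     ('x \<Rightarrow> 'y pmf) \<Rightarrow> bool" where
  "gvpo_optimal \<beta> R D \<pi>ref \<pi>s \<pi> \<longleftrightarrow>
     \<pi> \<in> policies D \<pi>ref \<and>
     (\<forall>\<pi>'\<in>policies D \<pi>ref. gvpo_loss \<beta> R D \<pi>ref \<pi>s \<pi> \<le> gvpo_loss \<beta> R D \<pi>ref \<pi>s \<pi>')"

text \<open>Note that \<open>KL_divergence b M N\<close> is the divergence of \<open>N\<close> from \<open>M\<close>, usually written D(N || M).\<close>

definition kl_integrand ::
    "real \<Rightarrow> ('x \<Rightarrow> 'y \<Rightarrow> real) \<Rightarrow> ('x \<Rightarrow> 'y pmf) \<Rightarrow> ('x \<Rightarrow> 'y pmf) \<Rightarrow> 'x \<Rightarrow> real" where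
  "kl_integrand \<beta> R \<pi>ref \<pi> x =
     measure_pmf.expectation (\<pi> x) (R x)
       - \<beta> * KL_divergence (exp 1) (measure_pmf (\<pi>ref x)) (measure_pmf (\<pi> x))"

definition kl_objective ::
    "real \<Rightarrow> ('x \<Rightarrow> 'y \<Rightarrow> real) \<Rightarrow> 'x pmf \<Rightarrow> ('x \<Rightarrow> 'y pmf) \<Rightarrow> ('x \<Rightarrow> 'y pmf) \<Rightarrow> real" where
  "kl_objective \<beta> R D \<pi>ref \<pi> = measure_pmf.expectation D (kl_integrand \<beta> R \<pi>ref \<pi>)"

text \<open>The policies for which the KL-constrained objective is well defined and finite.\<close>

definition kl_feasible ::
    "real \<Rightarrow> ('x \<Rightarrow> 'y \<Rightarrow> real) \<Rightarrow> 'x pmf \<Rightarrow> ('x \<Rightarrow> 'y pmf) \<Rightarrow> ('x \<Rightarrow> 'y pmf) \<Rightarrow> bool" where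
  "kl_feasible \<beta> R D \<pi>ref \<pi> \<longleftrightarrow>
     \<pi> \<in> policies D \<pi>ref \<and>
     (\<forall>x\<in>set_pmf D. integrable (measure_pmf (\<pi> x)) (R x) \<and>
        integrable (measure_pmf (\<pi> x))
          (entropy_density (exp 1) (measure_pmf (\<pi>ref x)) (measure_pmf (\<pi> x)))) \<and>
     integrable (measure_pmf D) (kl_integrand \<beta> R \<pi>ref \<pi>)"

definition kl_optimal ::
    "real \<Rightarrow> ('x \<Rightarrow> 'y \<Rightarrow> real) \<Rightarrow> 'x pmf \<Rightarrow> ('x \<Rightarrow> 'y pmf) \<Rightarrow> ('x \<Rightarrow> 'y pmf) \<Rightarrow> bool" where
  "kl_optimal \<beta> R D \<pi>ref \<pi> \<longleftrightarrow>
     kl_feasible \<beta> R D \<pi>ref \<pi> \<and>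
     (\<forall>\<pi>'. kl_feasible \<beta> R D \<pi>ref \<pi>' \<longrightarrow>
        kl_objective \<beta> R D \<pi>ref \<pi>' \<le> kl_objective \<beta> R D \<pi>ref \<pi>)"

end

theory Submission
  imports Defs
begin

text \<open>
  Both problems decouple over prompts.  With \<open>\<pi>*\<close> the Gibbs policy, the KL-regularized objective at
  \<open>x\<close> equals \<open>\<beta> ln Z(x) - \<beta> KL(\<pi> || \<pi>*)\<close>, so the strict positivity of the divergence decides it.
  The GVPO loss vanishes at \<open>\<pi>*\<close>; conversely, if it vanishes, the implicit reward differs from \<open>R\<close>
  by a constant depending on the prompt only, so \<open>\<pi>\<close> is proportional to \<open>\<pi>*\<close>, and normalization
  makes them equal.
\<close>

section \<open>Normalization and finite approximation of probability mass functions\<close>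

lemma pmf_has_sum_1: "(pmf p has_sum 1) UNIV"
proof -
  have "Infinite_Set_Sum.abs_summable_on (pmf p) UNIV"
    by (rule pmf_abs_summable)
  then show ?thesis
    by (metis abs_summable_equivalent abs_summable_summable has_sum_infsum infsetsum_infsum
        infsetsum_pmf_eq_1 subset_UNIV)
qed

text \<open>Summing both sides over all points forces \<open>k = 1\<close>.\<close>

lemma pmf_eqI_proportional:
  assumes eq: "\<And>y. pmf p y = k * pmf q y"
  shows "p = q"
proof -
  have "((\<lambda>y. k * pmf q y) has_sum k * 1) UNIV"
    by (intro has_sum_cmult_right pmf_has_sum_1)
  then have "(pmf p has_sum k) UNIV"
    by (simp flip: eq)
  then have "k = 1"
    using has_sum_unique[OF pmf_has_sum_1] by simp
  with eq show ?thesis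
    by (simp add: pmf_eqI)
qed

text \<open>The finite partial sums of \<open>pmf p\<close> tend to 1; intersecting with the support
  loses no mass.\<close>

lemma pmf_finite_approx:
  fixes p :: "'a pmf"
  assumes "c < 1"
  obtains F where "finite F" "F \<subseteq> set_pmf p" "measure (measure_pmf p) F > c"
proof -
  have "eventually (\<lambda>F. sum (pmf p) F > c) (finite_subsets_at_top UNIV)"
    using pmf_has_sum_1[of p] assms unfolding has_sum_def by (rule order_tendstoD)
  then obtain F where F: "finite F" "sum (pmf p) F > c"
    unfolding eventually_finite_subsets_at_top by blast
  show thesis
  proof
    show "measure (measure_pmf p) (F \<inter> set_pmf p) > c"
      using F by (simp add: measure_Int_set_pmf measure_measure_pmf_finite)
  qed (use F in auto)
qed

section \<open>Relative entropy between probability mass functions\<close>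

lemma absolutely_continuous_pmf:
  assumes "set_pmf p \<subseteq> set_pmf q"
  shows "absolutely_continuous (measure_pmf q) (measure_pmf p)"
  using assms by (auto simp: absolutely_continuous_def null_sets_def measure_pmf.emeasure_eq_measure
      measure_pmf_zero_iff)

text \<open>A Radon-Nikodym derivative is determined only almost everywhere, but comparing the
  masses of \<open>{y}\<close> fixes its value at each atom of \<open>q\<close>.\<close>

lemma entropy_density_pmf:
  assumes "set_pmf p \<subseteq> set_pmf q" "y \<in> set_pmf p"
  shows "entropy_density b (measure_pmf q) (measure_pmf p) y = log b (pmf p y / pmf q y)"
proof -
  have "emeasure (measure_pmf p) {y} = RN_deriv q p y * emeasure (measure_pmf q) {y}"
    by (intro measure_pmf.RN_deriv_singleton absolutely_continuous_pmf assms) auto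
  then have "pmf p y = enn2real (RN_deriv q p y) * pmf q y"
    by (metis emeasure_pmf_single enn2real_mult enn2real_ennreal pmf_nonneg)
  moreover have "pmf q y \<noteq> 0"
    using assms by (auto simp: set_pmf_iff)
  ultimately show ?thesis
    by (simp add: entropy_density_def)
qed

lemma KL_divergence_pmf:
  assumes "set_pmf p \<subseteq> set_pmf q"
  shows "KL_divergence b (measure_pmf q) (measure_pmf p) =
    measure_pmf.expectation p (\<lambda>y. log b (pmf p y / pmf q y))"
  unfolding KL_divergence_def
  by (intro integral_cong_AE) (auto simp: AE_measure_pmf_iff entropy_density_pmf assms)

lemma KL_divergence_pmf_same: "KL_divergence b (measure_pmf p) (measure_pmf p) = 0"
  by (rule sigma_finite_measure.KL_same_eq_0[OF measure_pmf.sigma_finite_measure_axioms])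

lemma measure_pmf_eq_density_ratio:
  assumes "set_pmf p \<subseteq> set_pmf q"
  shows "measure_pmf p = density (measure_pmf q) (\<lambda>y. ennreal (pmf p y / pmf q y))"
proof -
  \<comment> \<open>Off the support of \<open>q\<close> both sides vanish, \<open>p\<close> having
    no mass there.\<close>
  have "ennreal (pmf p y) = ennreal (pmf q y) * ennreal (pmf p y / pmf q y)" for y
    using assms by (cases "y \<in> set_pmf q") (auto simp: ennreal_mult[symmetric] set_pmf_iff)
  then show ?thesis
    unfolding measure_pmf_eq_density[of p] measure_pmf_eq_density[of q]
    by (subst density_density_eq) (auto simp: fun_eq_iff)
qed

text \<open>With \<open>p\<close> written as a density over \<open>q\<close>, this is the strict
  Gibbs inequality. Integrability excludes an infinite divergence, for which the Bochner integral
  takes the default value 0.\<close>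

lemma KL_divergence_pmf_pos:
  assumes pq: "set_pmf p \<subseteq> set_pmf q" and "p \<noteq> q" and b: "b > 1"
    and int: "integrable (measure_pmf p) (entropy_density b (measure_pmf q) (measure_pmf p))"
  shows "KL_divergence b (measure_pmf q) (measure_pmf p) > 0"
proof -
  let ?D = "\<lambda>y. pmf p y / pmf q y"
  interpret information_space "measure_pmf q" b
    by standard (rule b)
  note dens = measure_pmf_eq_density_ratio[OF pq]
  have "integrable (measure_pmf p) (\<lambda>y. log b (?D y))"
    using int by (subst integrable_cong_AE[of _ _ "entropy_density b q p"])
      (auto simp: AE_measure_pmf_iff entropy_density_pmf pq)
  then have "integrable (measure_pmf q) (\<lambda>y. ?D y * log b (?D y))"
    unfolding dens by (subst (asm) integrable_real_density) auto
  moreover have "density (measure_pmf q) ?D \<noteq> measure_pmf q"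
    using \<open>p \<noteq> q\<close> dens by (metis measure_pmf_inject)
  ultimately show ?thesis
    unfolding dens using dens
    by (intro KL_gt_0) (auto, metis prob_space_measure_pmf)
qed

text \<open>Conditioning divides \<open>q\<close> on \<open>F\<close> by the constant mass of
  \<open>F\<close>, so the log-ratio is constant. The divergence thus becomes arbitrarily small as
  \<open>F\<close> exhausts \<open>q\<close>.\<close>

lemma KL_divergence_cond_pmf:
  assumes F: "F \<subseteq> set_pmf q" "F \<noteq> {}"
  shows "KL_divergence (exp 1) (measure_pmf q) (cond_pmf q F) = - ln (measure (measure_pmf q) F)"
proof -
  have ne: "set_pmf q \<inter> F \<noteq> {}"
    using F by auto
  have set: "set_pmf (cond_pmf q F) = F"
    using F by (auto simp: set_cond_pmf[OF ne])
  have "measure (measure_pmf q) F > 0"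
    using ne by (simp add: measure_pmf_posI less_le measure_pmf_zero_iff)
  then have *: "log (exp 1) (pmf (cond_pmf q F) y / pmf q y) = - ln (measure (measure_pmf q) F)"
    if "y \<in> F" for y
    using that F pmf_positive[of y q] by (auto simp: pmf_cond[OF ne] log_def ln_div)
  have "KL_divergence (exp 1) (measure_pmf q) (cond_pmf q F) =
      measure_pmf.expectation (cond_pmf q F) (\<lambda>y. log (exp 1) (pmf (cond_pmf q F) y / pmf q y))"
    using F set by (intro KL_divergence_pmf) simp
  also have "\<dots> = measure_pmf.expectation (cond_pmf q F) (\<lambda>_. - ln (measure (measure_pmf q) F))"
    by (intro integral_cong_AE) (auto simp: AE_measure_pmf_iff set *)
  finally show ?thesis
    by simp
qed

section \<open>Competing policies and the Gibbs policy\<close>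

lemma policies_iff_set_pmf:
  "\<pi> \<in> policies D \<pi>ref \<longleftrightarrow> (\<forall>x\<in>set_pmf D. set_pmf (\<pi> x) \<subseteq> set_pmf (\<pi>ref x))"
  by (auto simp: policies_def subset_iff pmf_positive_iff)

locale kl_regularization =
  fixes \<beta> :: real and R :: "'x \<Rightarrow> 'y \<Rightarrow> real" and \<pi>ref :: "'x \<Rightarrow> 'y pmf"
  assumes \<beta>: "\<beta> > 0"
    and summable: "(\<lambda>y. pmf (\<pi>ref x) y * exp (R x y / \<beta>)) summable_on UNIV"
begin

text \<open>Any response in the support of \<open>\<pi>ref x\<close> contributes a positive term,
  and summability bounds the infinite sum below by it.\<close>

lemma partition_fun_pos: "partition_fun \<beta> R \<pi>ref x > 0"
proof -
  obtain y where y: "y \<in> set_pmf (\<pi>ref x)"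
    using set_pmf_not_empty by fast
  have "0 < (\<Sum>y\<in>{y}. pmf (\<pi>ref x) y * exp (R x y / \<beta>))"
    using y by (simp add: pmf_positive)
  also have "\<dots> \<le> partition_fun \<beta> R \<pi>ref x"
    unfolding partition_fun_def using summable by (intro finite_sum_le_infsum) auto
  finally show ?thesis .
qed

text \<open>The Boltzmann distribution with base measure \<open>\<pi>ref x\<close>, energy
  \<open>- R x\<close> and temperature \<beta>.\<close>

definition gibbs_policy :: "'x \<Rightarrow> 'y pmf" where
  "gibbs_policy x =
     embed_pmf (\<lambda>y. 1 / partition_fun \<beta> R \<pi>ref x * pmf (\<pi>ref x) y * exp (R x y / \<beta>))"

lemma pmf_gibbs_policy:
  "pmf (gibbs_policy x) y =
    1 / partition_fun \<beta> R \<pi>ref x * pmf (\<pi>ref x) y * exp (R x y / \<beta>)"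
  unfolding gibbs_policy_def
proof (rule pmf_embed_pmf)
  \<comment> \<open>Bracketed so that the inner product is the summand of the partition
    function.\<close>
  let ?f = "\<lambda>y. 1 / partition_fun \<beta> R \<pi>ref x * (pmf (\<pi>ref x) y * exp (R x y / \<beta>))"
  note pos = partition_fun_pos[of x]
  have nonneg: "?f y \<ge> 0" for y
    using pos by simp
  have "?f summable_on UNIV"
    by (rule summable_on_cmult_right[OF summable])
  then have "Infinite_Set_Sum.abs_summable_on ?f UNIV"
    by (intro abs_summable_equivalent[THEN iffD1] summable_on_iff_abs_summable_on_real[THEN iffD1])
  moreover have "infsum ?f UNIV = 1"
    unfolding infsum_cmult_right[OF summable] using pos by (simp add: partition_fun_def)
  ultimately have "(\<integral>\<^sup>+y. ?f y \<partial>count_space UNIV) = 1"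
    using nonneg by (subst nn_integral_conv_infsetsum) (auto simp: infsetsum_infsum)
  then show "(\<integral>\<^sup>+y. ennreal (1 / partition_fun \<beta> R \<pi>ref x * pmf (\<pi>ref x) y * exp (R x y / \<beta>))
      \<partial>count_space UNIV) = 1"
    by (simp only: mult.assoc)
  show "1 / partition_fun \<beta> R \<pi>ref x * pmf (\<pi>ref x) y * exp (R x y / \<beta>) \<ge> 0" for y
    using nonneg by (simp only: mult.assoc)
qed

lemma set_pmf_gibbs_policy: "set_pmf (gibbs_policy x) = set_pmf (\<pi>ref x)"
  using partition_fun_pos[of x] by (auto simp: set_pmf_iff pmf_gibbs_policy)

section \<open>The KL-constrained objective\<close>

text \<open>The logarithm of a Gibbs probability is that of the reference probability plus
  \<open>R x y / \<beta>\<close> minus the logarithm of the partition function.\<close>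

lemma entropy_density_gibbs_policy:
  assumes sub: "set_pmf p \<subseteq> set_pmf (\<pi>ref x)" and y: "y \<in> set_pmf p"
  shows "entropy_density (exp 1) (gibbs_policy x) p y =
    entropy_density (exp 1) (\<pi>ref x) p y - R x y / \<beta> + ln (partition_fun \<beta> R \<pi>ref x)"
proof -
  have "pmf p y > 0" "pmf (\<pi>ref x) y > 0"
    using sub y by (auto simp: pmf_positive_iff)
  then show ?thesis
    using partition_fun_pos[of x] sub y
    by (simp add: entropy_density_pmf set_pmf_gibbs_policy pmf_gibbs_policy log_def ln_div ln_mult)
qed

text \<open>This is the Gibbs variational identity: reward and penalty merge into a single
  divergence from the Gibbs policy, and the other term does not depend on \<pi>. The two
  integrability assumptions allow the expectation to be split.\<close>

lemma
  assumes sub: "set_pmf (\<pi> x) \<subseteq> set_pmf (\<pi>ref x)"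
    and intR: "integrable (measure_pmf (\<pi> x)) (R x)"
    and intE: "integrable (measure_pmf (\<pi> x)) (entropy_density (exp 1) (\<pi>ref x) (\<pi> x))"
  shows integrable_entropy_density_gibbs_policy:
      "integrable (measure_pmf (\<pi> x)) (entropy_density (exp 1) (gibbs_policy x) (\<pi> x))"
        (is ?int)
    and kl_integrand_eq: "kl_integrand \<beta> R \<pi>ref \<pi> x =
      \<beta> * ln (partition_fun \<beta> R \<pi>ref x)
        - \<beta> * KL_divergence (exp 1) (gibbs_policy x) (\<pi> x)" (is ?eq)
proof -
  let ?g = "\<lambda>y. entropy_density (exp 1) (\<pi>ref x) (\<pi> x) y - R x y / \<beta>
    + ln (partition_fun \<beta> R \<pi>ref x)"
  have AE: "AE y in measure_pmf (\<pi> x).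
      entropy_density (exp 1) (gibbs_policy x) (\<pi> x) y = ?g y"
    using entropy_density_gibbs_policy[OF sub]
    by (simp add: AE_measure_pmf_iff)
  have "integrable (measure_pmf (\<pi> x)) ?g"
    using intR intE by simp
  then show ?int
    using integrable_cong_AE[OF _ _ AE] by simp
  have "KL_divergence (exp 1) (gibbs_policy x) (\<pi> x) = measure_pmf.expectation (\<pi> x) ?g"
    unfolding KL_divergence_def using AE by (intro integral_cong_AE) auto
  also have "\<dots> = KL_divergence (exp 1) (\<pi>ref x) (\<pi> x) - measure_pmf.expectation (\<pi> x) (R x) / \<beta>
      + ln (partition_fun \<beta> R \<pi>ref x)"
    using intR intE by (simp add: KL_divergence_def)
  finally show ?eq
    using \<beta> by (simp add: kl_integrand_def field_simps)
qed

text \<open>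
  The Gibbs policy itself need not be feasible, so it cannot serve as the better competitor;
  its restriction to a large finite set of responses, used at the single prompt \<open>x\<close>, can.
\<close>

lemma kl_optimal_imp_gibbs_policy:
  assumes opt: "kl_optimal \<beta> R D \<pi>ref \<pi>" and x: "x \<in> set_pmf D"
  shows "\<pi> x = gibbs_policy x"
proof (rule ccontr)
  assume neq: "\<pi> x \<noteq> gibbs_policy x"
  define q where "q = gibbs_policy x"
  have set_q: "set_pmf q = set_pmf (\<pi>ref x)"
    unfolding q_def by (rule set_pmf_gibbs_policy)
  have feas: "kl_feasible \<beta> R D \<pi>ref \<pi>"
    using opt by (simp add: kl_optimal_def)
  then have sub: "set_pmf (\<pi> x) \<subseteq> set_pmf (\<pi>ref x)"
    and intR: "integrable (measure_pmf (\<pi> x)) (R x)"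
    and intE: "integrable (measure_pmf (\<pi> x)) (entropy_density (exp 1) (\<pi>ref x) (\<pi> x))"
    using x by (auto simp: kl_feasible_def policies_iff_set_pmf)
  define K where "K = KL_divergence (exp 1) q (\<pi> x)"
  have "K > 0"
    unfolding K_def using neq sub set_q
      integrable_entropy_density_gibbs_policy[of \<pi> x, OF sub intR intE]
    by (intro KL_divergence_pmf_pos) (auto simp: q_def)
  \<comment> \<open>The threshold \<open>exp (- K)\<close> is chosen because conditioning on a set
    of larger mass gives a divergence \<open>- ln\<close> of that mass, hence below
    \<open>K\<close>.\<close>
  then have "exp (- K) < 1"
    by simp
  then obtain F where F: "finite F" "F \<subseteq> set_pmf q" "measure (measure_pmf q) F > exp (- K)"
    by (rule pmf_finite_approx)
  then have "F \<noteq> {}"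
    by auto
  define p where "p = cond_pmf q F"
  have set_p: "set_pmf p = F"
    unfolding p_def using F \<open>F \<noteq> {}\<close> by (subst set_cond_pmf) auto
  define \<pi>' where "\<pi>' = \<pi>(x := p)"
  have \<pi>'_x: "\<pi>' x = p" and \<pi>'_other: "z \<noteq> x \<Longrightarrow> \<pi>' z = \<pi> z" for z
    by (auto simp: \<pi>'_def)
  \<comment> \<open>Finite support makes every function integrable, so feasibility of the competitor
    at \<open>x\<close> is automatic.\<close>
  have fin: "integrable (measure_pmf p) f" for f :: "_ \<Rightarrow> real"
    using F set_p by (intro integrable_measure_pmf_finite) auto
  define d where "d = kl_integrand \<beta> R \<pi>ref \<pi>' x - kl_integrand \<beta> R \<pi>ref \<pi> x"
  have "KL_divergence (exp 1) q p = - ln (measure (measure_pmf q) F)"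
    unfolding p_def using F \<open>F \<noteq> {}\<close> by (intro KL_divergence_cond_pmf)
  also have "\<dots> < K"
    using F(3) by (metis exp_gt_zero exp_less_cancel_iff exp_ln minus_less_iff order_less_trans)
  \<comment> \<open>Applied to both policies at \<open>x\<close>, the identity gives
    \<open>d\<close> as \<beta> times the difference of the divergences of \<open>\<pi> x\<close>
    and \<open>p\<close> from \<open>q\<close>.\<close>
  finally have "d > 0"
    unfolding d_def
    using \<beta> kl_integrand_eq[of \<pi> x, OF sub intR intE]
      kl_integrand_eq[of \<pi>' x] sub set_p set_q F fin
    by (simp add: \<pi>'_x K_def q_def)
  \<comment> \<open>Changing the policy at one prompt adds a multiple of an indicator, so
    integrability over \<open>D\<close> is kept and the objective grows by
    \<open>pmf D x * d\<close>.\<close>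
  have eq: "kl_integrand \<beta> R \<pi>ref \<pi>' = (\<lambda>z. kl_integrand \<beta> R \<pi>ref \<pi> z + indicator {x} z * d)"
    by (auto simp: fun_eq_iff d_def kl_integrand_def \<pi>'_other split: split_indicator)
  have int: "integrable (measure_pmf D) (kl_integrand \<beta> R \<pi>ref \<pi>)"
    using feas by (simp add: kl_feasible_def)
  have int_ind: "integrable (measure_pmf D) (\<lambda>z. indicator {x} z * d)"
    by (intro integrable_mult_left) (simp add: measure_pmf.emeasure_eq_measure)
  have "kl_feasible \<beta> R D \<pi>ref \<pi>'"
    unfolding kl_feasible_def
  proof (intro conjI ballI)
    show "\<pi>' \<in> policies D \<pi>ref"
      using feas F set_p set_q
      by (auto simp: kl_feasible_def policies_iff_set_pmf \<pi>'_def)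
    show "integrable (measure_pmf D) (kl_integrand \<beta> R \<pi>ref \<pi>')"
      unfolding eq using int int_ind by (rule Bochner_Integration.integrable_add)
    fix z assume "z \<in> set_pmf D"
    then show "integrable (measure_pmf (\<pi>' z)) (R z)"
      "integrable (measure_pmf (\<pi>' z)) (entropy_density (exp 1) (\<pi>ref z) (\<pi>' z))"
      using feas fin by (auto simp: kl_feasible_def \<pi>'_def)
  qed
  then have "kl_objective \<beta> R D \<pi>ref \<pi>' \<le> kl_objective \<beta> R D \<pi>ref \<pi>"
    using opt by (simp add: kl_optimal_def)
  moreover have "kl_objective \<beta> R D \<pi>ref \<pi>' = kl_objective \<beta> R D \<pi>ref \<pi> + pmf D x * d"
    unfolding kl_objective_def eq
    using int int_ind by (simp add: measure_pmf_single)
  moreover have "pmf D x * d > 0"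
    using x \<open>d > 0\<close> by (intro mult_pos_pos pmf_positive)
  ultimately show False
    by linarith
qed

text \<open>Feasibility stays on the right because the Gibbs policy may lack it. If it is feasible,
  the variational identity and the nonnegativity of the divergence make it optimal prompt by prompt,
  and integrating over \<open>D\<close> preserves the inequality.\<close>

lemma kl_optimal_iff:
  "kl_optimal \<beta> R D \<pi>ref \<pi> \<longleftrightarrow>
    kl_feasible \<beta> R D \<pi>ref \<pi> \<and> (\<forall>x\<in>set_pmf D. \<pi> x = gibbs_policy x)"
proof
  assume "kl_optimal \<beta> R D \<pi>ref \<pi>"
  then show "kl_feasible \<beta> R D \<pi>ref \<pi> \<and> (\<forall>x\<in>set_pmf D. \<pi> x = gibbs_policy x)"
    using kl_optimal_imp_gibbs_policy by (auto simp: kl_optimal_def)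
next
  assume "kl_feasible \<beta> R D \<pi>ref \<pi> \<and> (\<forall>x\<in>set_pmf D. \<pi> x = gibbs_policy x)"
  then have feas: "kl_feasible \<beta> R D \<pi>ref \<pi>"
    and gibbs: "\<And>x. x \<in> set_pmf D \<Longrightarrow> \<pi> x = gibbs_policy x"
    by auto
  have eq: "kl_integrand \<beta> R \<pi>ref \<sigma> x = \<beta> * ln (partition_fun \<beta> R \<pi>ref x)
      - \<beta> * KL_divergence (exp 1) (gibbs_policy x) (\<sigma> x)"
    if "kl_feasible \<beta> R D \<pi>ref \<sigma>" "x \<in> set_pmf D" for \<sigma> x
    using that by (intro kl_integrand_eq) (auto simp: kl_feasible_def policies_iff_set_pmf)
  have "kl_objective \<beta> R D \<pi>ref \<pi>' \<le> kl_objective \<beta> R D \<pi>ref \<pi>"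
    if feas': "kl_feasible \<beta> R D \<pi>ref \<pi>'" for \<pi>'
    unfolding kl_objective_def
  proof (rule integral_mono_AE)
    show "AE x in measure_pmf D. kl_integrand \<beta> R \<pi>ref \<pi>' x \<le> kl_integrand \<beta> R \<pi>ref \<pi> x"
      unfolding AE_measure_pmf_iff
    proof
      fix x assume x: "x \<in> set_pmf D"
      have sub: "set_pmf (\<pi>' x) \<subseteq> set_pmf (\<pi>ref x)"
        and intR: "integrable (measure_pmf (\<pi>' x)) (R x)"
        and intE: "integrable (measure_pmf (\<pi>' x)) (entropy_density (exp 1) (\<pi>ref x) (\<pi>' x))"
        using feas' x by (auto simp: kl_feasible_def policies_iff_set_pmf)
      have "KL_divergence (exp 1) (gibbs_policy x) (\<pi>' x) \<ge> 0"
      proof (cases "\<pi>' x = gibbs_policy x")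
        case True
        then show ?thesis
          by (simp add: KL_divergence_pmf_same)
      next
        case False
        then show ?thesis
          using sub set_pmf_gibbs_policy[of x]
            integrable_entropy_density_gibbs_policy[of \<pi>' x, OF sub intR intE]
          by (intro less_imp_le[OF KL_divergence_pmf_pos]) auto
      qed
      then show "kl_integrand \<beta> R \<pi>ref \<pi>' x \<le> kl_integrand \<beta> R \<pi>ref \<pi> x"
        using \<beta> by (simp add: eq[OF feas' x] eq[OF feas x] gibbs[OF x] KL_divergence_pmf_same)
    qed
  qed (use feas feas' in \<open>auto simp: kl_feasible_def\<close>)
  with feas show "kl_optimal \<beta> R D \<pi>ref \<pi>"
    by (simp add: kl_optimal_def)
qed

section \<open>The implicit reward and the GVPO loss\<close>

text \<open>The implicit reward inverts the Gibbs formula; where \<open>\<pi>ref\<close> vanishes,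
  its convention supplies \<open>R\<close>. Since the functions coincide everywhere, so do their
  means, default values included.\<close>

lemma implicit_reward_gibbs_policy:
  assumes \<pi>: "\<pi> x = gibbs_policy x"
  shows "implicit_reward \<beta> R \<pi>ref \<pi> x = R x"
proof
  fix y
  note Z = partition_fun_pos[of x]
  show "implicit_reward \<beta> R \<pi>ref \<pi> x y = R x y"
  proof (cases "pmf (\<pi>ref x) y = 0")
    case True
    then show ?thesis
      by (simp add: implicit_reward_def \<pi> pmf_gibbs_policy)
  next
    case False
    then have "pmf (\<pi> x) y / pmf (\<pi>ref x) y = exp (R x y / \<beta>) / partition_fun \<beta> R \<pi>ref x"
      by (simp add: \<pi> pmf_gibbs_policy)
    then have "ln (pmf (\<pi> x) y / pmf (\<pi>ref x) y) = R x y / \<beta> - ln (partition_fun \<beta> R \<pi>ref x)"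
      using Z by (simp add: ln_div)
    with False \<beta> show ?thesis
      by (simp add: implicit_reward_def right_diff_distrib)
  qed
qed

text \<open>Exponentiation turns the additive constant \<open>c\<close>, which centering leaves
  undetermined, into a factor.\<close>

lemma pmf_eq_if_implicit_reward_eq:
  assumes r: "implicit_reward \<beta> R \<pi>ref \<pi> x y = R x y + c"
    and pos: "pmf (\<pi> x) y > 0" "pmf (\<pi>ref x) y > 0"
  shows "pmf (\<pi> x) y = exp (c / \<beta>) * pmf (gibbs_policy x) y"
proof -
  note Z = partition_fun_pos[of x]
  have "ln (pmf (\<pi> x) y / pmf (\<pi>ref x) y) + ln (partition_fun \<beta> R \<pi>ref x) = R x y / \<beta> + c / \<beta>"
    using r pos \<beta> by (simp add: implicit_reward_def field_simps)
  then have "exp (ln (pmf (\<pi> x) y / pmf (\<pi>ref x) y) + ln (partition_fun \<beta> R \<pi>ref x)) =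
      exp (R x y / \<beta> + c / \<beta>)"
    by simp
  then have "pmf (\<pi> x) y / pmf (\<pi>ref x) y * partition_fun \<beta> R \<pi>ref x =
      exp (R x y / \<beta>) * exp (c / \<beta>)"
    using pos Z by (simp add: exp_add)
  then show ?thesis
    using pos Z by (simp add: pmf_gibbs_policy field_simps)
qed

text \<open>A nonnegative integral vanishes iff its integrand does so on the supports of
  \<open>D\<close> and \<open>\<pi>s\<close>; this rules out the infinite branch and leaves equality
  of rewards up to a constant per prompt. Coverage carries that equality to the whole support of
  \<open>\<pi>ref\<close>.\<close>

lemma gvpo_loss_eq_0_iff:
  assumes cover: "\<And>x. set_pmf (\<pi>ref x) \<subseteq> set_pmf (\<pi>s x)"
    and policy: "\<pi> \<in> policies D \<pi>ref"
  shows "gvpo_loss \<beta> R D \<pi>ref \<pi>s \<pi> = 0 \<longleftrightarrow> (\<forall>x\<in>set_pmf D. \<pi> x = gibbs_policy x)"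
proof -
  \<comment> \<open>From left to right it matters only that \<open>c x\<close> is independent of the
    response; for the Gibbs policy it is 0.\<close>
  define c where "c x = measure_pmf.expectation (\<pi>s x) (implicit_reward \<beta> R \<pi>ref \<pi> x)
    - measure_pmf.expectation (\<pi>s x) (R x)" for x
  have "gvpo_loss \<beta> R D \<pi>ref \<pi>s \<pi> = 0 \<longleftrightarrow>
      (\<forall>x\<in>set_pmf D. \<forall>y\<in>set_pmf (\<pi>s x). (pmf (\<pi> x) y = 0 \<longleftrightarrow> pmf (\<pi>ref x) y = 0) \<and>
         implicit_reward \<beta> R \<pi>ref \<pi> x y = R x y + c x)" (is "_ \<longleftrightarrow> (\<forall>x\<in>_. ?opt x)")
  proof -
    have "a - m - (b - n) = 0 \<longleftrightarrow> a = b + (m - n)" for a b m n :: real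
      by linarith
    then show ?thesis
      unfolding gvpo_loss_def c_def by (simp add: nn_integral_0_iff_AE AE_measure_pmf_iff) blast
  qed
  moreover have "?opt x \<longleftrightarrow> \<pi> x = gibbs_policy x" if x: "x \<in> set_pmf D" for x
  proof
    assume opt: "?opt x"
    have "pmf (\<pi> x) y = exp (c x / \<beta>) * pmf (gibbs_policy x) y" for y
    proof (cases "y \<in> set_pmf (\<pi>ref x)")
      case True
      then have "y \<in> set_pmf (\<pi>s x)"
        using cover by auto
      with True opt show ?thesis
        by (intro pmf_eq_if_implicit_reward_eq) (auto simp: set_pmf_iff less_le)
    next
      case False
      \<comment> \<open>Both sides are 0: \<pi> is an admissible policy, and the Gibbs policy has
        the support of \<open>\<pi>ref\<close>.\<close>
      then show ?thesis
        using policy x set_pmf_gibbs_policy[of x]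
        by (metis mult_zero_right pmf_eq_0_set_pmf policies_iff_set_pmf subsetD)
    qed
    then show "\<pi> x = gibbs_policy x"
      by (rule pmf_eqI_proportional)
  next
    assume gibbs: "\<pi> x = gibbs_policy x"
    then show "?opt x"
      using implicit_reward_gibbs_policy[of \<pi> x, OF gibbs] set_pmf_gibbs_policy[of x]
      by (auto simp: c_def pmf_eq_0_set_pmf)
  qed
  ultimately show ?thesis
    by simp
qed

text \<open>The loss is nonnegative and the Gibbs policy attains 0, so the minimizers are exactly
  the admissible policies of zero loss.\<close>

lemma gvpo_optimal_iff:
  assumes cover: "\<And>x. set_pmf (\<pi>ref x) \<subseteq> set_pmf (\<pi>s x)"
  shows "gvpo_optimal \<beta> R D \<pi>ref \<pi>s \<pi> \<longleftrightarrow> (\<forall>x\<in>set_pmf D. \<pi> x = gibbs_policy x)"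
proof -
  have policy: "\<sigma> \<in> policies D \<pi>ref" if "\<forall>x\<in>set_pmf D. \<sigma> x = gibbs_policy x" for \<sigma>
    using that set_pmf_gibbs_policy by (auto simp: policies_iff_set_pmf)
  note loss = gvpo_loss_eq_0_iff[OF cover]
  have opt: "gibbs_policy \<in> policies D \<pi>ref" "gvpo_loss \<beta> R D \<pi>ref \<pi>s gibbs_policy = 0"
    using policy[of gibbs_policy] loss[of gibbs_policy D] by auto
  show ?thesis
  proof
    assume "gvpo_optimal \<beta> R D \<pi>ref \<pi>s \<pi>"
    then have "\<pi> \<in> policies D \<pi>ref" "gvpo_loss \<beta> R D \<pi>ref \<pi>s \<pi> = 0"
      using opt by (auto simp: gvpo_optimal_def)
    then show "\<forall>x\<in>set_pmf D. \<pi> x = gibbs_policy x"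
      using loss by blast
  next
    assume "\<forall>x\<in>set_pmf D. \<pi> x = gibbs_policy x"
    then show "gvpo_optimal \<beta> R D \<pi>ref \<pi>s \<pi>"
      using policy[of \<pi>] loss[of \<pi> D] by (simp add: gvpo_optimal_def)
  qed
qed

end

theorem theorem3p2:
  fixes \<beta> :: real
    and R :: "'x \<Rightarrow> 'y \<Rightarrow> real"
    and D :: "'x pmf"
    and \<pi>ref \<pi>s :: "'x \<Rightarrow> 'y pmf"
  assumes "\<beta> > 0"
    and "\<forall>x. (\<lambda>y. pmf (\<pi>ref x) y * exp (R x y / \<beta>)) summable_on UNIV"
    and "\<forall>x. {y. pmf (\<pi>ref x) y > 0} \<subseteq> {y. pmf (\<pi>s x) y > 0}"
  shows "\<exists>\<pi>star :: 'x \<Rightarrow> 'y pmf.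
     (\<forall>x y. pmf (\<pi>star x) y
        = 1 / partition_fun \<beta> R \<pi>ref x * pmf (\<pi>ref x) y * exp (R x y / \<beta>)) \<and>
     (\<forall>\<pi>. kl_optimal \<beta> R D \<pi>ref \<pi> \<longleftrightarrow>
        kl_feasible \<beta> R D \<pi>ref \<pi> \<and> (\<forall>x\<in>set_pmf D. \<pi> x = \<pi>star x)) \<and>
     (\<forall>\<pi>. gvpo_optimal \<beta> R D \<pi>ref \<pi>s \<pi> \<longleftrightarrow> (\<forall>x\<in>set_pmf D. \<pi> x = \<pi>star x))"
proof -
  interpret kl_regularization \<beta> R \<pi>ref
    by standard (use assms in auto)
  have "set_pmf (\<pi>ref x) \<subseteq> set_pmf (\<pi>s x)" for x
    using assms(3) by (auto simp: subset_iff pmf_positive_iff)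
  then show ?thesis
    using pmf_gibbs_policy kl_optimal_iff gvpo_optimal_iff
    by (intro exI[of _ gibbs_policy]) simp
qed

end
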